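(* Let $(x_k),(y_k),(v_k),(A_k),(\gamma_k)$ be generated by the generalized Optimized Gradient Method (described in the context), and let $\bar{\mathcal D}_1 = \frac{2}{\gamma_1}\mathcal D_1$, where $$\mathcal D_1 = A_1\left(f(y_1)-f^*-\frac{\mu r}{2}\|x^*-x_1\|^2-\frac{1}{2L_f}\|g_1\|_*^2\right)+\frac{\gamma_1}{2}\|v_1-x^*\|^2 .$$ (i) If $\mu=0$, then for all $k\ge 2$ $$f(x_k)-f^*\le f(y_k)-\frac{1}{2L_f}\|g_k\|_*^2-f^*\le \frac{\mathcal D_1}{A_k}\le \frac{L_f}{k^2}\bar{\mathcal D}_1 .$$ (ii) If $\mu>0$ and $\gamma_1\ge 2\mu r A_1$, then for all $k\ge 2$ $$\|v_k-x^*\|^2\le \frac{2\mathcal D_1}{\gamma_k}\le\frac{\mathcal D_1}{\mu r A_k}\le (1-\sqrt q)^{2k-4}\,\frac{(1-q)^2}{4q}\,\bar{\mathcal D}_1$$ and $$f(v_k)-f^*\le \frac{L_f}{2}\|v_k-x^*\|^2\le (1-\sqrt q)^{2k-4}\,\frac{(1-q)^2L_f}{8q}\,\bar{\mathcal D}_1 .$$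
   Context: $\mathbb E$ is a finite-dimensional real vector space with dual $\mathbb E^*$, $\langle g,x\rangle$ is the value of $g\in\mathbb E^*$ at $x\in\mathbb E$, and $B:\mathbb E\to\mathbb E^*$ is self-adjoint positive definite. Norms: $\|x\|=\sqrt{\langle Bx,x\rangle}$, $\|g\|_*=\sqrt{\langle g,B^{-1}g\rangle}$. The function $f:\mathbb E\to\mathbb R$ is convex and differentiable, and for given $L_f>0$, $\mu\in[0,L_f)$ satisfies, for all $z_1,z_2\in\mathbb E$, $$\frac{\mu}{2}\|z_1-z_2\|^2\le f(z_1)-f(z_2)-\langle f'(z_2),z_1-z_2\rangle\le\frac{L_f}{2}\|z_1-z_2\|^2 .$$ $x^*$ is a fixed minimizer of $f$ (assumed to exist) and $f^*=f(x^* )$. Put $q=\mu/L_f$ and $r=L_f/(L_f-\mu)=1/(1-q)$. Generalized Optimized Gradient Method. Input: $x_0\in\mathbb E$, $A_1\ge0$, $\gamma_1>0$. Set $y_1=x_0$, $g_1=f'(y_1)$, $x_1=y_1-\frac1{L_f}B^{-1}g_1$, and choose any $v_1\in\mathbb E$. For $k=1,2,\dots$: $a_{k+1}=\frac{1}{L_f-\mu}\left(\gamma_k+\mu A_k+\sqrt{\gamma_k(\gamma_k+2L_fA_k)}\right)$; $A_{k+1}=A_k+a_{k+1}$; $\gamma_{k+1}=\gamma_k+2\mu r a_{k+1}$; $\bar a_{k+1}=r(a_{k+1}+qA_{k+1})$; $\bar\gamma_{k+1}=\gamma_{k+1}-\mu\bar a_{k+1}$; $y_{k+1}=(rA_k\bar\gamma_{k+1}+\bar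 a_{k+1}\gamma_k)^{-1}(rA_k\bar\gamma_{k+1}x_k+\bar a_{k+1}\gamma_kv_k)$; $g_{k+1}=f'(y_{k+1})$; $x_{k+1}=y_{k+1}-\frac1{L_f}B^{-1}g_{k+1}$; $v_{k+1}=\frac1{\gamma_{k+1}}\left(\bar\gamma_{k+1}v_k-\bar a_{k+1}(B^{-1}g_{k+1}-\mu y_{k+1})\right)$. *)

theory Defs
  imports "HOL-Analysis.Analysis"
begin

text \<open>The dual of the finite-dimensional space \<open>'a\<close> is \<open>'a \<Rightarrow>\<^sub>L real\<close>: in finite dimension every linear
  functional is bounded. The inner product and the norm of the class \<open>euclidean_space\<close> are
  never used for the geometry of the method; all norms below come from \<open>B\<close>.\<close>

definition self_adjoint_pos_def :: "('a::euclidean_space \<Rightarrow> ('a \<Rightarrow>\<^sub>L real)) \<Rightarrow> bool" where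
  "self_adjoint_pos_def B \<longleftrightarrow>
     linear B \<and>
     (\<forall>x y. blinfun_apply (B x) y = blinfun_apply (B y) x) \<and>
     (\<forall>x. x \<noteq> 0 \<longrightarrow> blinfun_apply (B x) x > 0)"

text \<open>A map \<open>B\<close> as above is bijective, so that \<open>inv B\<close> is its genuine inverse.\<close>

definition primal_norm :: "('a::euclidean_space \<Rightarrow> ('a \<Rightarrow>\<^sub>L real)) \<Rightarrow> 'a \<Rightarrow> real" where
  "primal_norm B x = sqrt (blinfun_apply (B x) x)"

definition dual_norm :: "('a::euclidean_space \<Rightarrow> ('a \<Rightarrow>\<^sub>L real)) \<Rightarrow> ('a \<Rightarrow>\<^sub>L real) \<Rightarrow> real" where
  "dual_norm B g = sqrt (blinfun_apply g (inv B g))"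

text \<open>Runs of the generalized Optimized Gradient Method. The starting point is \<open>x 0\<close>. The other
  sequences start at index 1 (\<open>a\<close>, \<open>a'\<close> and \<open>\<gamma>'\<close> at index 2), and their values at smaller
  indices are irrelevant. The sequences \<open>a'\<close> and \<open>\<gamma>'\<close> are the barred ones.\<close>

definition generalized_OGM ::
  "('a::euclidean_space \<Rightarrow> ('a \<Rightarrow>\<^sub>L real)) \<Rightarrow> real \<Rightarrow> real \<Rightarrow> ('a \<Rightarrow> ('a \<Rightarrow>\<^sub>L real)) \<Rightarrow>
   (nat \<Rightarrow> 'a) \<Rightarrow> (nat \<Rightarrow> 'a) \<Rightarrow> (nat \<Rightarrow> 'a) \<Rightarrow> (nat \<Rightarrow> ('a \<Rightarrow>\<^sub>L real)) \<Rightarrow>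
   (nat \<Rightarrow> real) \<Rightarrow> (nat \<Rightarrow> real) \<Rightarrow> (nat \<Rightarrow> real) \<Rightarrow> (nat \<Rightarrow> real) \<Rightarrow> (nat \<Rightarrow> real) \<Rightarrow> bool" where
  "generalized_OGM B L \<mu> f' x y v g a A \<gamma> a' \<gamma>' \<longleftrightarrow>
    (let q = \<mu> / L; r = L / (L - \<mu>) in
      A 1 \<ge> 0 \<and> \<gamma> 1 > 0 \<and>
      y 1 = x 0 \<and>
      g 1 = f' (y 1) \<and>
      x 1 = y 1 - (1 / L) *\<^sub>R inv B (g 1) \<and>
      (\<forall>k\<ge>1.
        a (k + 1) = 1 / (L - \<mu>) * (\<gamma> k + \<mu> * A k + sqrt (\<gamma> k * (\<gamma> k + 2 * L * A k))) \<and>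
        A (k + 1) = A k + a (k + 1) \<and>
        \<gamma> (k + 1) = \<gamma> k + 2 * \<mu> * r * a (k + 1) \<and>
        a' (k + 1) = r * (a (k + 1) + q * A (k + 1)) \<and>
        \<gamma>' (k + 1) = \<gamma> (k + 1) - \<mu> * a' (k + 1) \<and>
        y (k + 1) = inverse (r * A k * \<gamma>' (k + 1) + a' (k + 1) * \<gamma> k) *\<^sub>R
                      ((r * A k * \<gamma>' (k + 1)) *\<^sub>R x k + (a' (k + 1) * \<gamma> k) *\<^sub>R v k) \<and>
        g (k + 1) = f' (y (k + 1)) \<and>
        x (k + 1) = y (k + 1) - (1 / L) *\<^sub>R inv B (g (k + 1)) \<and>
        v (k + 1) = (1 / \<gamma> (k + 1)) *\<^sub>R
                      (\<gamma>' (k + 1) *\<^sub>R v k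
                       - a' (k + 1) *\<^sub>R (inv B (g (k + 1)) - \<mu> *\<^sub>R y (k + 1)))))"

end

theory Submission
  imports Defs
begin

text \<open>A potential function decreases along the iteration. With \<open>G\<close> the gradient relative to the form \<open>B\<close>
  and \<open>z - G z / L\<close> the gradient step from \<open>z\<close>, smoothness and strong convexity combine into the
  \<^emph>\<open>interpolation inequality\<close> (\<open>interpolation\<close>), which bounds \<open>f z1 - f z2\<close> from below by the
  linear term plus squared distances both of the gradients and of the gradient steps. The potential is
  \<open>A\<^sub>k\<close> times the slack of this inequality between \<open>y\<^sub>k\<close> and the minimiser plus
  \<open>\<gamma>\<^sub>k / 2\<close> times the squared distance of \<open>v\<^sub>k\<close> to the minimiser; its initial value is \<open>D1\<close>.

  Adding the interpolation inequalities from \<open>y\<^sub>k\<^sub>+\<^sub>1\<close> to \<open>y\<^sub>k\<close> and to the minimiser, with weights \<open>A\<^sub>k\<close> and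
  \<open>a\<^sub>k\<^sub>+\<^sub>1\<close>, shows that the potential decreases by at least a quadratic expression in four vectors, and the
  coefficients of the method are those for which this expression vanishes identically
  (\<open>OGM_coefficients\<close>, \<open>OGM_quadratic_identity\<close>, \<open>potential_step\<close>). Both summands of the potential
  are nonnegative, so each is at most \<open>D1\<close>.

  The rates then follow from the growth of \<open>A\<^sub>k\<close> alone. Each increment solves a quadratic equation.
  For \<open>\<mu> = 0\<close> this bounds the growth of \<open>sqrt A\<^sub>k\<close> from below by a linear rate (\<open>weight_growth_convex\<close>). For \<open>\<mu> > 0\<close> the
  relation \<open>\<gamma>\<^sub>k \<ge> 2 \<mu> r A\<^sub>k\<close> persists and forces \<open>A\<^sub>k\<close> to grow by a factor of at least \<open>(1 - sqrt q)\<^sup>-\<^sup>2\<close> at every step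
  (\<open>weight_growth_strongly_convex\<close>).\<close>

section \<open>The geometry of a positive definite form\<close>

locale spd_form =
  fixes B :: "'a::euclidean_space \<Rightarrow> ('a \<Rightarrow>\<^sub>L real)"
  assumes spd: "self_adjoint_pos_def B"
begin

abbreviation ip :: "'a \<Rightarrow> 'a \<Rightarrow> real" where
  "ip x y \<equiv> blinfun_apply (B x) y"

lemma linear_B: "linear B"
  using spd by (simp add: self_adjoint_pos_def_def)

lemma ip_sym: "ip x y = ip y x"
  using spd by (simp add: self_adjoint_pos_def_def)

lemma ip_pos: "x \<noteq> 0 \<Longrightarrow> ip x x > 0"
  using spd by (simp add: self_adjoint_pos_def_def)

lemmas ip_simps =
  linear_add[OF linear_B] linear_diff[OF linear_B] linear_cmul[OF linear_B]
  linear_neg[OF linear_B] linear_0[OF linear_B] blinfun.bilinear_simps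

lemma ip_nonneg: "ip x x \<ge> 0"
  using ip_pos[of x] by (cases "x = 0") (auto simp: ip_simps)

lemma inj_B: "inj B"
proof (subst linear_injective_0[OF linear_B], intro allI impI)
  fix x assume "B x = 0"
  then have "ip x x = 0" by simp
  with ip_pos[of x] show "x = 0" by fastforce
qed

text \<open>The dual is not itself a Euclidean space in the sense of the type class, so the fact that an
  injective linear map is surjective is applied to the endomorphism that lists the values of \<open>B x\<close> on a basis.\<close>

lemma surj_B: "surj B"
proof -
  define T where "T x = (\<Sum>b\<in>Basis. ip x b *\<^sub>R b)" for x :: 'a
  have T_coord: "T x \<bullet> b = ip x b" if "b \<in> Basis" for x b
    using that by (simp add: T_def)
  have lin: "linear T"
    by (rule linearI) (simp_all add: T_def ip_simps scaleR_add_left sum.distrib scaleR_sum_right)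
  have "inj T"
  proof (rule injI)
    fix x y assume "T x = T y"
    then have "B x = B y"
      by (metis T_coord blinfun_euclidean_eqI)
    with inj_B show "x = y" by (simp add: inj_eq)
  qed
  then have "surj T" using lin by (simp add: linear_injective_imp_surjective)
  have "\<exists>x. g = B x" for g
  proof -
    obtain x where x: "(\<Sum>b\<in>Basis. blinfun_apply g b *\<^sub>R b) = T x"
      using \<open>surj T\<close> by (meson surjD)
    have "blinfun_apply g b = ip x b" if "b \<in> Basis" for b
      using T_coord[OF that, of x] that by (simp flip: x)
    then show ?thesis by (metis blinfun_euclidean_eqI)
  qed
  then show ?thesis by (auto simp: surj_def)
qed

lemma B_inv: "B (inv B g) = g"
  by (rule surj_f_inv_f[OF surj_B])

lemma primal_norm_square: "(primal_norm B x)\<^sup>2 = ip x x"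
  by (simp add: primal_norm_def ip_nonneg)

lemma dual_norm_square: "(dual_norm B g)\<^sup>2 = ip (inv B g) (inv B g)"
  using ip_nonneg[of "inv B g"] by (simp add: dual_norm_def B_inv)

end

section \<open>Smooth strongly convex functions\<close>

text \<open>The gradient \<open>G\<close> is taken with respect to the form, so that all vectors live in the
  primal space.\<close>

locale smooth_strongly_convex = spd_form B
  for B :: "'a::euclidean_space \<Rightarrow> ('a \<Rightarrow>\<^sub>L real)" +
  fixes f :: "'a \<Rightarrow> real" and G :: "'a \<Rightarrow> 'a" and L \<mu> r :: real
  assumes mu: "0 \<le> \<mu>" "\<mu> < L"
    and r: "r = L / (L - \<mu>)"
    and lower: "\<mu> / 2 * ip (z1 - z2) (z1 - z2) \<le> f z1 - f z2 - ip (G z2) (z1 - z2)"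
    and upper: "f z1 - f z2 - ip (G z2) (z1 - z2) \<le> L / 2 * ip (z1 - z2) (z1 - z2)"
begin

definition gstep :: "'a \<Rightarrow> 'a" where
  "gstep z = z - (1 / L) *\<^sub>R G z"

lemma gstep_decrease: "f (gstep z) \<le> f z - 1 / (2 * L) * ip (G z) (G z)"
proof -
  have "L > 0" using mu by simp
  have "gstep z - z = (- (1 / L)) *\<^sub>R G z" by (simp add: gstep_def)
  with upper[of "gstep z" z]
  have "f (gstep z) - f z + ip (G z) (G z) / L \<le> L / 2 * (ip (G z) (G z) / L / L)"
    by (simp add: ip_simps)
  with \<open>L > 0\<close> show ?thesis by simp
qed

text \<open>Both quadratic bounds hold at every \<open>z\<close>, the lower one around \<open>z2\<close> and the upper one around
  \<open>z1\<close>. Comparing them bounds \<open>f z1 - f z2\<close> below by a concave quadratic in \<open>z\<close>; the inequality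
  is its maximum.\<close>

lemma interpolation:
  "f z1 \<ge> f z2 + ip (G z2) (z1 - z2) + 1 / (2 * L) * ip (G z1 - G z2) (G z1 - G z2)
     + \<mu> * r / 2 * ip (gstep z1 - gstep z2) (gstep z1 - gstep z2)"
proof -
  define d where "d = L - \<mu>"
  have d: "d > 0" "L > 0" "\<mu> = L - d" using mu by (auto simp: d_def)
  define u e where "u = z1 - z2" and "e = G z1 - G z2"
  \<comment> \<open>the maximiser of the concave quadratic, relative to \<open>z1\<close>\<close>
  define w where "w = (1 / d) *\<^sub>R (\<mu> *\<^sub>R u - e)"
  have low: "\<mu> / 2 * ip (w + u) (w + u) \<le> f (z1 + w) - f z2 - ip (G z2) (w + u)"
    using lower[of "z1 + w" z2] by (simp add: u_def algebra_simps)
  have up: "f (z1 + w) - f z1 - ip (G z1) w \<le> L / 2 * ip w w"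
    using upper[of "z1 + w" z1] by simp
  have "ip (G z1) w = ip (G z2) w + ip e w"
    by (simp add: e_def ip_simps)
  with low up have main: "f z1 - f z2 - ip (G z2) u
      \<ge> \<mu> / 2 * ip (w + u) (w + u) - L / 2 * ip w w - ip e w"
    by (simp add: ip_simps)
  have gs: "gstep z1 - gstep z2 = u - (1 / L) *\<^sub>R e"
    by (simp add: gstep_def u_def e_def algebra_simps)
  have sym: "ip u e = ip e u" by (rule ip_sym)
  have "\<mu> / 2 * ip (w + u) (w + u) - L / 2 * ip w w - ip e w
      = 1 / (2 * L) * ip e e + \<mu> * r / 2 * ip (u - (1 / L) *\<^sub>R e) (u - (1 / L) *\<^sub>R e)"
    using d unfolding w_def r d_def[symmetric] d(3)
    by (simp add: ip_simps sym field_simps)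
  with main show ?thesis
    by (simp add: gs) (simp add: u_def e_def)
qed

end

section \<open>One step of the method\<close>

text \<open>Everything reduces to the quadratic equation
  \<open>((L - \<mu>) a - \<mu> A)\<^sup>2 = 2 \<gamma> (L - \<mu>) (A + a)\<close> solved by the new weight \<open>a\<close>. The three resulting
  equations are exactly what makes the remainder of one step vanish: the first for the terms linear
  in the minimiser, the other two for the constant terms.\<close>

lemma OGM_coefficients:
  fixes L \<mu> r q A \<gamma> a a' \<gamma>n \<gamma>' :: real
  assumes mu: "0 \<le> \<mu>" "\<mu> < L" and A: "A \<ge> 0" and g: "\<gamma> > 0"
    and r: "r = L / (L - \<mu>)" and q: "q = \<mu> / L"
    and a: "a = 1 / (L - \<mu>) * (\<gamma> + \<mu> * A + sqrt (\<gamma> * (\<gamma> + 2 * L * A)))"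
    and gn: "\<gamma>n = \<gamma> + 2 * \<mu> * r * a"
    and a': "a' = r * (a + q * (A + a))"
    and g': "\<gamma>' = \<gamma>n - \<mu> * a'"
  shows "a > 0" "a' > 0" "\<gamma>n > 0" "\<gamma>' > 0"
    and "\<gamma>' * (\<gamma>' - \<gamma>) = \<mu> * a' * \<gamma>"
    and "\<gamma>'\<^sup>2 = \<gamma> * \<gamma>n"
    and "L * a'\<^sup>2 = 2 * r * \<gamma>n * (A + a)"
proof -
  define d where "d = L - \<mu>"
  have d: "d > 0" "L > 0" "L = d + \<mu>" using mu by (auto simp: d_def)
  \<comment> \<open>in terms of \<open>t\<close>, both barred coefficients become linear after multiplication by \<open>d\<close>\<close>
  define t where "t = d * a - \<mu> * A"
  have da: "d * a = \<gamma> + \<mu> * A + sqrt (\<gamma> * (\<gamma> + 2 * L * A))"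
    using d by (simp add: a flip: d_def)
  have rad: "\<gamma> * (\<gamma> + 2 * L * A) \<ge> 0" using g A d by simp
  have tg: "t = \<gamma> + sqrt (\<gamma> * (\<gamma> + 2 * L * A))" by (simp add: t_def da)
  have t_pos: "t > 0" using tg g rad by (simp add: add_pos_nonneg)
  have "(t - \<gamma>)\<^sup>2 = \<gamma> * (\<gamma> + 2 * L * A)" using tg rad by simp
  then have t2: "t\<^sup>2 = 2 * \<gamma> * d * (A + a)"
    by (simp add: power2_eq_square d(3) algebra_simps t_def)
  have "d * a > 0" using t_pos mu A by (simp add: t_def) (smt (verit) mult_nonneg_nonneg)
  then show a_pos: "a > 0" using d by (simp add: zero_less_mult_iff)
  have dr: "d * r = L" using d by (simp add: r flip: d_def)
  have Lq: "L * q = \<mu>" using d by (simp add: q)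
  have "d * a' = (d * r) * a + (d * r) * q * (A + a)"
    by (simp add: a' algebra_simps)
  then have da': "d * a' = t + 2 * \<mu> * (A + a)"
    unfolding dr Lq by (simp add: t_def d(3) algebra_simps)
  have "d * a' > 0" using da' t_pos mu A a_pos by (simp add: add_pos_nonneg)
  then show "a' > 0" using d by (simp add: zero_less_mult_iff)
  have dgn: "d * \<gamma>n = d * \<gamma> + 2 * \<mu> * L * a"
    by (simp add: gn flip: dr) (simp add: algebra_simps)
  have "d * \<gamma>n > 0" using dgn d mu g a_pos by (simp add: add_pos_nonneg)
  then show "\<gamma>n > 0" using d by (simp add: zero_less_mult_iff)
  have "d * \<gamma>' = d * \<gamma>n - \<mu> * (d * a')" by (simp add: g' algebra_simps)
  then have dg': "d * \<gamma>' = d * \<gamma> + \<mu> * t"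
    unfolding dgn da' by (simp add: t_def d(3) algebra_simps)
  have "d * \<gamma>' > 0" using dg' t_pos mu d g by (simp add: add_pos_nonneg)
  then show "\<gamma>' > 0" using d by (simp add: zero_less_mult_iff)
  have "d * d * (\<gamma>' * (\<gamma>' - \<gamma>)) = (d * \<gamma>') * (d * \<gamma>' - d * \<gamma>)"
    by (simp add: algebra_simps)
  also have "\<dots> = \<mu> * (d * \<gamma> * t + \<mu> * t\<^sup>2)"
    unfolding dg' by (simp add: power2_eq_square algebra_simps)
  also have "\<dots> = d * \<mu> * \<gamma> * (d * a')"
    unfolding t2 da' by (simp add: algebra_simps)
  also have "\<dots> = d * d * (\<mu> * a' * \<gamma>)" by simp
  finally show S1: "\<gamma>' * (\<gamma>' - \<gamma>) = \<mu> * a' * \<gamma>" using d by simp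
  show "\<gamma>'\<^sup>2 = \<gamma> * \<gamma>n"
    using S1 by (simp add: g' power2_eq_square algebra_simps)
  have "(d * a')\<^sup>2 = t\<^sup>2 + 4 * \<mu> * (A + a) * (t + \<mu> * (A + a))"
    unfolding da' by (simp add: power2_eq_square algebra_simps)
  also have "t + \<mu> * (A + a) = L * a" by (simp add: t_def d(3) algebra_simps)
  finally have "(d * a')\<^sup>2 = 2 * (d * \<gamma>n) * (A + a)"
    unfolding t2 dgn by (simp add: algebra_simps)
  then have "d * (d * a'\<^sup>2) = d * (2 * \<gamma>n * (A + a))"
    by (simp add: power2_eq_square algebra_simps)
  then have "d * a'\<^sup>2 = 2 * \<gamma>n * (A + a)" using d by simp
  then have "r * (d * a'\<^sup>2) = 2 * r * \<gamma>n * (A + a)" by simp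
  then show "L * a'\<^sup>2 = 2 * r * \<gamma>n * (A + a)" by (simp flip: dr add: mult_ac)
qed

context spd_form
begin

text \<open>The remainder of one step, with the new point \<open>y\<close> as origin: \<open>p\<close>, \<open>V\<close>, \<open>s\<close> and \<open>W\<close> stand for
  the old \<open>x\<close>, the old \<open>v\<close>, the minimiser and the new \<open>v\<close>. The choice of \<open>y\<close> makes \<open>p\<close> and \<open>V\<close>
  parallel, so that products with \<open>p\<close> can be traded for products with \<open>V\<close>.\<close>

lemma OGM_quadratic_identity:
  fixes p V s W G :: 'a
  assumes L: "L > 0" and r: "L + \<mu> * r = L * r"
    and pos: "\<gamma> > 0" "\<gamma>n > 0" "\<gamma>' > 0"
    and S1: "\<gamma>' * (\<gamma>' - \<gamma>) = \<mu> * a' * \<gamma>"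
    and S2: "\<gamma>'\<^sup>2 = \<gamma> * \<gamma>n"
    and S3: "L * a'\<^sup>2 = 2 * r * \<gamma>n * (A + a)"
    and gn: "\<gamma>n = \<gamma> + 2 * \<mu> * r * a"
    and a': "L * a' = r * (L * a + \<mu> * (A + a))"
    and bal: "(r * A * \<gamma>') *\<^sub>R p + (a' * \<gamma>) *\<^sub>R V = 0"
    and W: "\<gamma>n *\<^sub>R W = \<gamma>' *\<^sub>R V - a' *\<^sub>R G"
  shows "A * ip G p + a * ip G s + (A + a) / L * ip G G
     + \<mu> * r * (A * ip (p + (1 / L) *\<^sub>R G) (s + (1 / L) *\<^sub>R G)
                + a * ip (s + (1 / L) *\<^sub>R G) (s + (1 / L) *\<^sub>R G))
     + \<gamma> / 2 * ip (V - s) (V - s) - \<gamma>n / 2 * ip (W - s) (W - s) = 0"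
proof -
  have bal_ip: "r * A * \<gamma>' * ip p z + a' * \<gamma> * ip V z = 0" for z
    using arg_cong[OF bal, of "\<lambda>u. ip u z"] by (simp add: ip_simps)
  have ps: "\<mu> * r * A * ip p s = - (\<gamma>' - \<gamma>) * ip V s"
  proof -
    have "\<gamma>' * (\<mu> * r * A * ip p s) = - (\<mu> * a' * \<gamma>) * ip V s"
      using bal_ip[of s] by algebra
    also have "\<dots> = \<gamma>' * (- (\<gamma>' - \<gamma>) * ip V s)" using S1 by algebra
    finally show ?thesis using pos by (metis mult_left_cancel less_irrefl)
  qed
  have pG: "\<gamma>n * (r * A * ip G p) = - a' * \<gamma>' * ip G V"
  proof -
    have "\<gamma> * (\<gamma>n * (r * A * ip G p)) = \<gamma>'\<^sup>2 * (r * A * ip p G)"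
      by (simp add: S2 ip_sym[of G p])
    also have "\<dots> = \<gamma> * (- a' * \<gamma>' * ip G V)"
      using bal_ip[of G] unfolding ip_sym[of V G] by algebra
    finally show ?thesis using pos by (metis mult_left_cancel less_irrefl)
  qed
  define N where "N = \<gamma>n * ip (W - s) (W - s)"
  have "\<gamma>n * N = ip (\<gamma>n *\<^sub>R W - \<gamma>n *\<^sub>R s) (\<gamma>n *\<^sub>R W - \<gamma>n *\<^sub>R s)"
    by (simp add: N_def ip_simps algebra_simps)
  also have "\<dots> = \<gamma>'\<^sup>2 * ip V V + 2 * (\<gamma>n * (r * A * ip G p)) + a'\<^sup>2 * ip G G
      - 2 * \<gamma>n * (\<gamma>' * ip V s - a' * ip G s) + \<gamma>n\<^sup>2 * ip s s"
    unfolding W pG by (simp add: ip_simps ip_sym[of V G] ip_sym[of s G] ip_sym[of s V]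
        power2_eq_square algebra_simps)
  also have "\<dots> = \<gamma>n * (\<gamma> * ip V V + 2 * r * A * ip G p + 2 * r * (A + a) / L * ip G G
      - 2 * (\<gamma>' * ip V s - a' * ip G s) + \<gamma>n * ip s s)"
  proof -
    have a'2: "a'\<^sup>2 = 2 * r * \<gamma>n * (A + a) / L" using S3 L by (simp add: field_simps)
    show ?thesis unfolding S2 a'2 by (simp add: power2_eq_square algebra_simps)
  qed
  finally have N: "N = \<gamma> * ip V V + 2 * r * A * ip G p + 2 * r * (A + a) / L * ip G G
      - 2 * (\<gamma>' * ip V s - a' * ip G s) + \<gamma>n * ip s s"
    using pos by simp
  have "\<mu> * r = L * (r - 1)" using r by (simp add: algebra_simps)
  have cross: "\<mu> * r * (A * ip (p + (1 / L) *\<^sub>R G) (s + (1 / L) *\<^sub>R G)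
        + a * ip (s + (1 / L) *\<^sub>R G) (s + (1 / L) *\<^sub>R G))
      = \<mu> * r * A * ip p s + (r - 1) * A * ip G p + (r - 1) * (A + 2 * a) * ip G s
        + (r - 1) * (A + a) / L * ip G G + \<mu> * r * a * ip s s"
    unfolding \<open>\<mu> * r = L * (r - 1)\<close>
    using L by (simp add: ip_simps ip_sym[of p G] ip_sym[of s G] field_simps)
  have a'': "a' = r * a + (r - 1) * (A + a)"
  proof -
    have "L * a' = L * (r * a + (r - 1) * (A + a))"
      unfolding a' using \<open>\<mu> * r = L * (r - 1)\<close> by algebra
    then show ?thesis using L by simp
  qed
  have "ip (V - s) (V - s) = ip V V - 2 * ip V s + ip s s"
    by (simp add: ip_simps ip_sym[of s V])
  moreover have "\<gamma>n / 2 * ip (W - s) (W - s) = N / 2" by (simp add: N_def)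
  ultimately show ?thesis
    by (simp only: cross N ps a'' gn) (simp add: algebra_simps add_divide_distrib diff_divide_distrib)
qed

end
context smooth_strongly_convex
begin

text \<open>For a minimiser \<open>xs\<close>, the amount by which the interpolation inequality between \<open>y\<close> and \<open>xs\<close>
  is slack, hence nonnegative.\<close>

definition gap :: "'a \<Rightarrow> 'a \<Rightarrow> real" where
  "gap xs y = f y - f xs - \<mu> * r / 2 * ip (xs - gstep y) (xs - gstep y)
     - 1 / (2 * L) * ip (G y) (G y)"

definition potential :: "'a \<Rightarrow> real \<Rightarrow> real \<Rightarrow> 'a \<Rightarrow> 'a \<Rightarrow> real" where
  "potential xs A \<gamma> y v = A * gap xs y + \<gamma> / 2 * ip (v - xs) (v - xs)"

lemma gap_nonneg:
  assumes "G xs = 0"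
  shows "gap xs y \<ge> 0"
proof -
  have "gstep xs = xs" using assms by (simp add: gstep_def)
  then have "f xs + 1 / (2 * L) * ip (G y) (G y) + \<mu> * r / 2 * ip (gstep y - xs) (gstep y - xs) \<le> f y"
    using interpolation[of xs y] assms by (simp add: ip_simps)
  moreover have "ip (gstep y - xs) (gstep y - xs) = ip (xs - gstep y) (xs - gstep y)"
    by (simp add: ip_simps)
  ultimately show ?thesis by (simp add: gap_def)
qed

text \<open>Add \<open>A\<close> times the interpolation inequality from the new point to the old one and \<open>a\<close> times the
  one from the new point to the minimiser. The function values then cancel against those of the
  potential, and the quadratic terms left over add up to zero.\<close>

lemma potential_step:
  fixes y v y' v' xs :: 'a
  assumes opt: "G xs = 0"
    and A: "A \<ge> 0" and g: "\<gamma> > 0" and q: "q = \<mu> / L"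
    and a: "a = 1 / (L - \<mu>) * (\<gamma> + \<mu> * A + sqrt (\<gamma> * (\<gamma> + 2 * L * A)))"
    and gn: "\<gamma>n = \<gamma> + 2 * \<mu> * r * a"
    and a': "a' = r * (a + q * (A + a))"
    and g': "\<gamma>' = \<gamma>n - \<mu> * a'"
    and y': "y' = inverse (r * A * \<gamma>' + a' * \<gamma>) *\<^sub>R ((r * A * \<gamma>') *\<^sub>R gstep y + (a' * \<gamma>) *\<^sub>R v)"
    and v': "v' = (1 / \<gamma>n) *\<^sub>R (\<gamma>' *\<^sub>R v - a' *\<^sub>R (G y' - \<mu> *\<^sub>R y'))"
  shows "potential xs (A + a) \<gamma>n y' v' \<le> potential xs A \<gamma> y v"
proof -
  note coeff = OGM_coefficients[OF mu A g r q a gn a' g']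
  have L: "L > 0" using mu by simp
  have r_pos: "r > 0" using mu by (simp add: r)
  have den: "r * A * \<gamma>' + a' * \<gamma> > 0"
    using coeff g A r_pos by (simp add: add_nonneg_pos)
  define p V s W where "p = gstep y - y'" and "V = v - y'" and "s = xs - y'" and "W = v' - y'"
  have "(r * A * \<gamma>' + a' * \<gamma>) *\<^sub>R y' = (r * A * \<gamma>') *\<^sub>R gstep y + (a' * \<gamma>) *\<^sub>R v"
    using den by (simp add: y')
  then have bal: "(r * A * \<gamma>') *\<^sub>R p + (a' * \<gamma>) *\<^sub>R V = 0"
    by (simp add: p_def V_def algebra_simps)
  have "\<gamma>n *\<^sub>R v' = \<gamma>' *\<^sub>R v - a' *\<^sub>R (G y' - \<mu> *\<^sub>R y')"
    using coeff by (simp add: v')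
  moreover have "\<gamma>n *\<^sub>R y' = (\<gamma>' + \<mu> * a') *\<^sub>R y'" by (simp add: g')
  ultimately have W: "\<gamma>n *\<^sub>R W = \<gamma>' *\<^sub>R V - a' *\<^sub>R G y'"
    by (simp add: W_def V_def algebra_simps)
  have Lr: "L + \<mu> * r = L * r" using mu by (simp add: r field_simps)
  have La': "L * a' = r * (L * a + \<mu> * (A + a))" using L by (simp add: a' q field_simps)
  define P S X where
    "P = ip (p + (1 / L) *\<^sub>R G y') (p + (1 / L) *\<^sub>R G y')" and
    "S = ip (s + (1 / L) *\<^sub>R G y') (s + (1 / L) *\<^sub>R G y')" and
    "X = ip (p + (1 / L) *\<^sub>R G y') (s + (1 / L) *\<^sub>R G y')"
  define m where "m = \<mu> * r"
  define h h0 where "h = ip (G y') (G y') / L" and "h0 = ip (G y) (G y) / L"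
  have "A * ip (G y') p + a * ip (G y') s + (A + a) / L * ip (G y') (G y')
      + \<mu> * r * (A * X + a * S)
      + \<gamma> / 2 * ip (V - s) (V - s) - \<gamma>n / 2 * ip (W - s) (W - s) = 0"
    unfolding X_def S_def
    by (rule OGM_quadratic_identity[OF L Lr g coeff(3,4,5,6,7) gn La' bal W])
  then have ident: "A * ip (G y') p + a * ip (G y') s + (A + a) * (ip (G y') (G y') / L)
      + m * (A * X + a * S)
      + \<gamma> / 2 * ip (v - xs) (v - xs) - \<gamma>n / 2 * ip (v' - xs) (v' - xs) = 0"
    by (simp add: V_def W_def s_def m_def)
  have y_split: "y - y' = p + (1 / L) *\<^sub>R G y" by (simp add: p_def gstep_def)
  have "gstep y - gstep y' = p + (1 / L) *\<^sub>R G y'" by (simp add: p_def gstep_def)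
  with interpolation[of y' y] have "f y' + ip (G y') (y - y')
      + 1 / (2 * L) * ip (G y - G y') (G y - G y') + m / 2 * P \<le> f y"
    by (simp add: P_def m_def)
  moreover have "ip (G y') (y - y') + 1 / (2 * L) * ip (G y - G y') (G y - G y')
      = ip (G y') p + ip (G y') (G y') / L / 2 + ip (G y) (G y) / L / 2"
    unfolding y_split using L by (simp add: ip_simps ip_sym[of "G y" "G y'"] field_simps)
  ultimately have J1: "f y' + ip (G y') p + ip (G y') (G y') / L / 2 + m / 2 * P
      \<le> f y - ip (G y) (G y) / L / 2"
    by linarith
  have s_split: "xs - gstep y' = s + (1 / L) *\<^sub>R G y'" by (simp add: s_def gstep_def)
  have "gstep xs = xs" using opt by (simp add: gstep_def)
  with interpolation[of y' xs] s_split
  have J2: "f y' + ip (G y') s + ip (G y') (G y') / L / 2 + m / 2 * S \<le> f xs"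
    by (simp add: opt S_def m_def s_def ip_simps)
  have "xs - gstep y = (s + (1 / L) *\<^sub>R G y') - (p + (1 / L) *\<^sub>R G y')"
    by (simp add: s_def p_def)
  \<comment> \<open>the term of the old gap at \<open>xs\<close>, expressed through the quantities centred at \<open>y'\<close>\<close>
  then have polar: "ip (xs - gstep y) (xs - gstep y) = S + P - 2 * X"
    by (simp only: linear_diff[OF linear_B] blinfun.diff_left blinfun.diff_right)
      (simp add: S_def P_def X_def ip_sym[of "s + (1 / L) *\<^sub>R G y'" "p + (1 / L) *\<^sub>R G y'"])
  have gap_old: "gap xs y = f y - f xs - m / 2 * (S + P - 2 * X) - ip (G y) (G y) / L / 2"
    by (simp add: gap_def polar m_def)
  have gap_new: "gap xs y' = f y' - f xs - m / 2 * S - ip (G y') (G y') / L / 2"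
    by (simp add: gap_def s_split S_def m_def)
  have "A * (f y' + ip (G y') p + ip (G y') (G y') / L / 2 + m / 2 * P)
      \<le> A * (f y - ip (G y) (G y) / L / 2)"
    using J1 A by (rule mult_left_mono)
  moreover have "a * (f y' + ip (G y') s + ip (G y') (G y') / L / 2 + m / 2 * S) \<le> a * f xs"
    using J2 coeff(1) by (intro mult_left_mono) auto
  ultimately show ?thesis
    using ident unfolding potential_def gap_old gap_new h_def[symmetric] h0_def[symmetric]
    by (simp add: algebra_simps add_divide_distrib)
qed

end

section \<open>Growth of the weights\<close>

text \<open>The weight \<open>A\<close> may vanish initially, so the growth estimates below only start to act
  after one step, from this bound.\<close>

lemma weight_first_increment:
  fixes L \<mu> A \<gamma> :: real
  assumes "0 \<le> \<mu>" "\<mu> < L" "A \<ge> 0" "\<gamma> > 0"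
  shows "2 * \<gamma> / (L - \<mu>)
    \<le> 1 / (L - \<mu>) * (\<gamma> + \<mu> * A + sqrt (\<gamma> * (\<gamma> + 2 * L * A)))"
proof -
  have "\<gamma> \<le> sqrt (\<gamma> * (\<gamma> + 2 * L * A))"
    using assms by (intro real_le_rsqrt) (simp add: power2_eq_square algebra_simps)
  moreover have "\<mu> * A \<ge> 0" using assms by simp
  ultimately have "2 * \<gamma> \<le> \<gamma> + \<mu> * A + sqrt (\<gamma> * (\<gamma> + 2 * L * A))" by linarith
  then show ?thesis using assms by (simp add: divide_right_mono)
qed

lemma weight_growth_convex:
  fixes L A \<gamma> \<kappa> :: real
  assumes L: "L > 0" and g: "\<gamma> > 0" and \<kappa>: "\<kappa> \<ge> 0" and A: "\<kappa>\<^sup>2 * \<gamma> / (2 * L) \<le> A"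
  shows "(\<kappa> + 1)\<^sup>2 * \<gamma> / (2 * L) \<le> A + 1 / L * (\<gamma> + sqrt (\<gamma> * (\<gamma> + 2 * L * A)))"
proof -
  have LA: "\<kappa>\<^sup>2 * \<gamma> \<le> 2 * L * A" using A L by (simp add: field_simps)
  have "(\<gamma> * \<kappa>)\<^sup>2 = \<gamma> * (\<kappa>\<^sup>2 * \<gamma>)" by (simp add: power2_eq_square)
  also have "\<dots> \<le> \<gamma> * (\<gamma> + 2 * L * A)"
    using LA g by (intro mult_left_mono) auto
  finally have root: "\<gamma> * \<kappa> \<le> sqrt (\<gamma> * (\<gamma> + 2 * L * A))" by (rule real_le_rsqrt)
  have "(\<kappa> + 1)\<^sup>2 * \<gamma> \<le> 2 * L * A + 2 * (\<gamma> + sqrt (\<gamma> * (\<gamma> + 2 * L * A)))"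
    using LA root g by (simp add: power2_eq_square algebra_simps)
  then show ?thesis using L by (simp add: field_simps)
qed

text \<open>The increment is monotone in \<open>\<gamma>\<close>, so the extreme case is \<open>\<gamma> = 2 \<mu> r A\<close>. There the radicand is
  a perfect square and the growth factor is exactly \<open>(1 - sqrt q)\<^sup>-\<^sup>2\<close>.\<close>

lemma weight_growth_strongly_convex:
  fixes L \<mu> r q A \<gamma> :: real
  assumes mu: "0 < \<mu>" "\<mu> < L" and A: "A \<ge> 0" and r: "r = L / (L - \<mu>)" and q: "q = \<mu> / L"
    and g: "2 * \<mu> * r * A \<le> \<gamma>"
  shows "A \<le> (1 - sqrt q)\<^sup>2
    * (A + 1 / (L - \<mu>) * (\<gamma> + \<mu> * A + sqrt (\<gamma> * (\<gamma> + 2 * L * A))))"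
proof -
  define s where "s = sqrt q"
  have L: "L > 0" using mu by simp
  have s: "0 < s" "s < 1" using mu L by (auto simp: s_def q)
  have "q = s\<^sup>2" using mu L by (simp add: s_def q)
  then have mu_s: "\<mu> = L * s\<^sup>2" using L by (simp add: q field_simps)
  define t where "t = 1 - s\<^sup>2"
  have t: "t > 0" using s by (simp add: t_def power_less_one_iff)
  have d: "L - \<mu> = L * t" by (simp add: mu_s t_def algebra_simps)
  have g': "2 * L * s\<^sup>2 * A / t \<le> \<gamma>"
  proof -
    have "2 * \<mu> * r * A = 2 * L * s\<^sup>2 * A / t"
      unfolding r d using L by (simp add: mu_s)
    with g show ?thesis by simp
  qed
  have base: "0 \<le> 2 * L * s\<^sup>2 * A / t" using L A t by simp
  have "(2 * L * s * A / t)\<^sup>2 = 2 * L * s\<^sup>2 * A / t * (2 * L * s\<^sup>2 * A / t + 2 * L * A)"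
  proof -
    have "2 * L * s\<^sup>2 * A / t + 2 * L * A = 2 * L * A * (s\<^sup>2 + t) / t"
      using t by (simp add: field_simps)
    then show ?thesis by (simp add: t_def power2_eq_square)
  qed
  also have "\<dots> \<le> \<gamma> * (\<gamma> + 2 * L * A)"
    using g' base L A by (intro mult_mono) auto
  finally have root: "2 * L * s * A / t \<le> sqrt (\<gamma> * (\<gamma> + 2 * L * A))"
    by (rule real_le_rsqrt)
  have "(1 + s)\<^sup>2 / t\<^sup>2 * A = A + 1 / (L * t) * (2 * L * s\<^sup>2 * A / t + L * s\<^sup>2 * A + 2 * L * s * A / t)"
  proof -
    have "A + 1 / (L * t) * (2 * L * s\<^sup>2 * A / t + L * s\<^sup>2 * A + 2 * L * s * A / t)
        = (t * t + 2 * s\<^sup>2 + s\<^sup>2 * t + 2 * s) / t\<^sup>2 * A"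
      using L t by (simp add: field_simps power2_eq_square)
    also have "t * t + 2 * s\<^sup>2 + s\<^sup>2 * t + 2 * s = (1 + s)\<^sup>2"
      by (simp add: t_def power2_eq_square algebra_simps)
    finally show ?thesis by simp
  qed
  also have "\<dots> \<le> A + 1 / (L - \<mu>) * (\<gamma> + \<mu> * A + sqrt (\<gamma> * (\<gamma> + 2 * L * A)))"
    unfolding d using g' root L t
    by (intro add_left_mono mult_left_mono) (auto simp: mu_s)
  finally have "(1 - s)\<^sup>2 * ((1 + s)\<^sup>2 / t\<^sup>2 * A)
      \<le> (1 - s)\<^sup>2 * (A + 1 / (L - \<mu>) * (\<gamma> + \<mu> * A + sqrt (\<gamma> * (\<gamma> + 2 * L * A))))"
    by (rule mult_left_mono) simp
  moreover have "(1 - s)\<^sup>2 * (1 + s)\<^sup>2 = t\<^sup>2"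
    by (simp add: t_def power2_eq_square algebra_simps)
  then have "(1 - s)\<^sup>2 * ((1 + s)\<^sup>2 / t\<^sup>2 * A) = A"
    using t by (simp flip: mult.assoc)
  ultimately show ?thesis by (simp add: s_def)
qed

section \<open>The convergence rates\<close>

theorem mainTheorem1:
  fixes B :: "'a::euclidean_space \<Rightarrow> ('a \<Rightarrow>\<^sub>L real)"
    and f :: "'a \<Rightarrow> real"
    and f' :: "'a \<Rightarrow> ('a \<Rightarrow>\<^sub>L real)"
    and L \<mu> q r D1 Dbar1 fstar :: real
    and xstar :: 'a
    and x y v :: "nat \<Rightarrow> 'a"
    and g :: "nat \<Rightarrow> ('a \<Rightarrow>\<^sub>L real)"
    and a A \<gamma> a' \<gamma>' :: "nat \<Rightarrow> real"
  assumes B: "self_adjoint_pos_def B"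
    and L: "L > 0"
    and mu: "0 \<le> \<mu>" "\<mu> < L"
    and convex: "convex_on UNIV f"
    and deriv: "\<And>z. (f has_derivative blinfun_apply (f' z)) (at z)"
    and bounds: "\<And>z1 z2.
        \<mu> / 2 * (primal_norm B (z1 - z2))\<^sup>2 \<le> f z1 - f z2 - blinfun_apply (f' z2) (z1 - z2) \<and>
        f z1 - f z2 - blinfun_apply (f' z2) (z1 - z2) \<le> L / 2 * (primal_norm B (z1 - z2))\<^sup>2"
    and minimizer: "\<And>z. f xstar \<le> f z"
    and fstar: "fstar = f xstar"
    and q: "q = \<mu> / L"
    and r: "r = L / (L - \<mu>)"
    and iterates: "generalized_OGM B L \<mu> f' x y v g a A \<gamma> a' \<gamma>'"
    and D1: "D1 = A 1 * (f (y 1) - fstar - \<mu> * r / 2 * (primal_norm B (xstar - x 1))\<^sup>2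
                          - 1 / (2 * L) * (dual_norm B (g 1))\<^sup>2)
                  + \<gamma> 1 / 2 * (primal_norm B (v 1 - xstar))\<^sup>2"
    and Dbar1: "Dbar1 = 2 / \<gamma> 1 * D1"
  shows "(\<mu> = 0 \<longrightarrow>
            (\<forall>k\<ge>2.
               f (x k) - fstar \<le> f (y k) - 1 / (2 * L) * (dual_norm B (g k))\<^sup>2 - fstar \<and>
               f (y k) - 1 / (2 * L) * (dual_norm B (g k))\<^sup>2 - fstar \<le> D1 / A k \<and>
               D1 / A k \<le> L / (real k)\<^sup>2 * Dbar1))
       \<and> (\<mu> > 0 \<and> \<gamma> 1 \<ge> 2 * \<mu> * r * A 1 \<longrightarrow>
            (\<forall>k\<ge>2.
               (primal_norm B (v k - xstar))\<^sup>2 \<le> 2 * D1 / \<gamma> k \<and>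
               2 * D1 / \<gamma> k \<le> D1 / (\<mu> * r * A k) \<and>
               D1 / (\<mu> * r * A k) \<le> (1 - sqrt q) ^ (2 * k - 4) * ((1 - q)\<^sup>2 / (4 * q)) * Dbar1 \<and>
               f (v k) - fstar \<le> L / 2 * (primal_norm B (v k - xstar))\<^sup>2 \<and>
               L / 2 * (primal_norm B (v k - xstar))\<^sup>2
                 \<le> (1 - sqrt q) ^ (2 * k - 4) * ((1 - q)\<^sup>2 * L / (8 * q)) * Dbar1))"
proof -
  define G where "G z = inv B (f' z)" for z
  interpret spd_form B using B by unfold_locales
  have BG: "B (G z) = f' z" for z by (simp add: G_def B_inv)
  interpret smooth_strongly_convex B f G L \<mu> r
    using mu r bounds by unfold_locales (auto simp: BG primal_norm_square)
  have "f' xstar = 0"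
  proof (rule blinfun_eqI)
    have "blinfun_apply (f' xstar) = (\<lambda>h. 0)"
      by (rule differential_zero_maxmin[OF _ open_UNIV deriv]) (use minimizer in auto)
    then show "blinfun_apply (f' xstar) z = blinfun_apply 0 z" for z by simp
  qed
  then have opt: "G xstar = 0"
    using BG[of xstar] inj_B linear_0[OF linear_B] by (metis injD)

  note run = iterates[unfolded generalized_OGM_def Let_def, folded q r]
  have A1: "A 1 \<ge> 0" and g1: "\<gamma> 1 > 0" using run by blast+
  have step:
    "a (k + 1) = 1 / (L - \<mu>) * (\<gamma> k + \<mu> * A k + sqrt (\<gamma> k * (\<gamma> k + 2 * L * A k)))"
    "A (k + 1) = A k + a (k + 1)"
    "\<gamma> (k + 1) = \<gamma> k + 2 * \<mu> * r * a (k + 1)"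
    "a' (k + 1) = r * (a (k + 1) + q * (A k + a (k + 1)))"
    "\<gamma>' (k + 1) = \<gamma> (k + 1) - \<mu> * a' (k + 1)"
    "y (k + 1) = inverse (r * A k * \<gamma>' (k + 1) + a' (k + 1) * \<gamma> k) *\<^sub>R
                      ((r * A k * \<gamma>' (k + 1)) *\<^sub>R x k + (a' (k + 1) * \<gamma> k) *\<^sub>R v k)"
    "v (k + 1) = (1 / \<gamma> (k + 1)) *\<^sub>R
                      (\<gamma>' (k + 1) *\<^sub>R v k
                       - a' (k + 1) *\<^sub>R (inv B (g (k + 1)) - \<mu> *\<^sub>R y (k + 1)))"
    if "k \<ge> 1" for k
    using run that by simp_all
  have grads: "inv B (g k) = G (y k) \<and> x k = gstep (y k)" if "k \<ge> 1" for k
  proof (cases "k = 1")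
    case True
    then show ?thesis using run by (simp add: G_def gstep_def)
  next
    case False
    with that have "k - 1 \<ge> 1" "k - 1 + 1 = k" by auto
    then have "g k = f' (y k)" "x k = y k - (1 / L) *\<^sub>R inv B (g k)"
      using run by metis+
    then show ?thesis by (simp add: G_def gstep_def)
  qed
  define Phi where "Phi k = potential xstar (A k) (\<gamma> k) (y k) (v k)" for k
  have inv: "A k \<ge> 0 \<and> \<gamma> k > 0 \<and> Phi k \<le> Phi 1" if "k \<ge> 1" for k
    using that
  proof (induction k rule: nat_induct_at_least)
    case base
    show ?case using A1 g1 by simp
  next
    case (Suc k)
    note st = step[OF Suc.hyps]
    have "k + 1 \<ge> 1" by simp
    note coeff = OGM_coefficients[OF mu _ _ r q st(1,3,4,5)]
    have "Phi (k + 1) \<le> Phi k"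
      unfolding Phi_def st(2)
      by (rule potential_step[OF opt _ _ q st(1,3,4,5)
            st(6)[unfolded grads[OF Suc.hyps, THEN conjunct2]]
            st(7)[unfolded grads[OF \<open>k + 1 \<ge> 1\<close>, THEN conjunct1]]])
        (use Suc.IH in auto)
    then show ?case using Suc.IH coeff(1,3) st(2) by simp
  qed
  have gap: "gap xstar (y k) = f (y k) - fstar - \<mu> * r / 2 * (primal_norm B (xstar - x k))\<^sup>2
      - 1 / (2 * L) * (dual_norm B (g k))\<^sup>2" if "k \<ge> 1" for k
    using grads[OF that] by (simp add: gap_def fstar primal_norm_square dual_norm_square)
  have D1_Phi: "D1 = Phi 1"
    by (simp add: D1 Phi_def potential_def gap primal_norm_square flip: gap[OF order_refl])
  have D1_nonneg: "D1 \<ge> 0"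
    unfolding D1_Phi Phi_def potential_def using A1 g1 gap_nonneg[OF opt] ip_nonneg by simp
  have Phi_bound: "A k * gap xstar (y k) + \<gamma> k / 2 * (primal_norm B (v k - xstar))\<^sup>2 \<le> D1"
    if "k \<ge> 1" for k
    using inv[OF that] by (simp add: D1_Phi Phi_def potential_def primal_norm_square)
  have A2: "2 * \<gamma> 1 / (L - \<mu>) \<le> A 2"
    using weight_first_increment[OF mu A1 g1] step(1,2)[of 1] A1 by (simp add: numeral_2_eq_2)
  have A_pos: "A k > 0" if "k \<ge> 2" for k
    using that
  proof (induction k rule: nat_induct_at_least)
    case base
    have "2 * \<gamma> 1 / (L - \<mu>) > 0" using g1 mu by simp
    with A2 show ?case by simp
  next
    case (Suc k)
    then show ?case
      using inv[of k] step(1,2)[of k] OGM_coefficients(1)[OF mu _ _ r q step(1,3,4,5), of k] by simp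
  qed

  have convex_case: "f (x k) - fstar \<le> f (y k) - 1 / (2 * L) * (dual_norm B (g k))\<^sup>2 - fstar \<and>
      f (y k) - 1 / (2 * L) * (dual_norm B (g k))\<^sup>2 - fstar \<le> D1 / A k \<and>
      D1 / A k \<le> L / (real k)\<^sup>2 * Dbar1" if "\<mu> = 0" "k \<ge> 2" for k
  proof (intro conjI)
    have k: "k \<ge> 1" using that by simp
    show "f (x k) - fstar \<le> f (y k) - 1 / (2 * L) * (dual_norm B (g k))\<^sup>2 - fstar"
      using gstep_decrease[of "y k"] grads[OF k] by (simp add: dual_norm_square)
    have "0 \<le> \<gamma> k / 2 * (primal_norm B (v k - xstar))\<^sup>2"
      using inv[OF k] by simp
    then have "gap xstar (y k) * A k \<le> D1" using Phi_bound[OF k] by (simp add: mult.commute)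
    then have "gap xstar (y k) \<le> D1 / A k"
      using A_pos[OF that(2)] by (simp add: pos_le_divide_eq)
    then show "f (y k) - 1 / (2 * L) * (dual_norm B (g k))\<^sup>2 - fstar \<le> D1 / A k"
      using gap[OF k] that by simp
    have "\<gamma> k = \<gamma> 1 \<and> (real k)\<^sup>2 * \<gamma> 1 / (2 * L) \<le> A k"
      using \<open>k \<ge> 2\<close>
    proof (induction k rule: nat_induct_at_least)
      case base
      \<comment> \<open>the first increment alone is at least \<open>2\<^sup>2 \<gamma> / (2 L)\<close>\<close>
      show ?case using A2 step(3)[of 1] that by (simp add: numeral_2_eq_2)
    next
      case (Suc k)
      then have "k \<ge> 1" by simp
      with weight_growth_convex[OF L g1, of "real k" "A k"] Suc.IH step(1,2,3)[of k] that
      show ?case by (simp add: add.commute)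
    qed
    then have "(real k)\<^sup>2 * \<gamma> 1 / (2 * L) \<le> A k" by simp
    moreover have "(real k)\<^sup>2 * \<gamma> 1 / (2 * L) > 0" using that g1 L by simp
    ultimately have "D1 / A k \<le> D1 / ((real k)\<^sup>2 * \<gamma> 1 / (2 * L))"
      using D1_nonneg A_pos[OF \<open>k \<ge> 2\<close>] by (intro divide_left_mono mult_pos_pos)
    also have "\<dots> = L / (real k)\<^sup>2 * Dbar1" by (simp add: Dbar1)
    finally show "D1 / A k \<le> L / (real k)\<^sup>2 * Dbar1" .
  qed

  have strong_case: "(primal_norm B (v k - xstar))\<^sup>2 \<le> 2 * D1 / \<gamma> k \<and>
      2 * D1 / \<gamma> k \<le> D1 / (\<mu> * r * A k) \<and>
      D1 / (\<mu> * r * A k) \<le> (1 - sqrt q) ^ (2 * k - 4) * ((1 - q)\<^sup>2 / (4 * q)) * Dbar1 \<and>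
      f (v k) - fstar \<le> L / 2 * (primal_norm B (v k - xstar))\<^sup>2 \<and>
      L / 2 * (primal_norm B (v k - xstar))\<^sup>2
        \<le> (1 - sqrt q) ^ (2 * k - 4) * ((1 - q)\<^sup>2 * L / (8 * q)) * Dbar1"
    if mu_pos: "\<mu> > 0" and g1_ge: "\<gamma> 1 \<ge> 2 * \<mu> * r * A 1" and k2: "k \<ge> 2" for k
  proof -
    have k: "k \<ge> 1" using k2 by simp
    have q01: "0 < q" "q < 1" using mu_pos mu L by (auto simp: q)
    have r_pos: "r > 0" using mu L by (simp add: r)
    \<comment> \<open>preserved because \<open>\<gamma>\<close> grows by exactly \<open>2 \<mu> r\<close> times the increment of \<open>A\<close>\<close>
    have ratio: "2 * \<mu> * r * A j \<le> \<gamma> j" if "j \<ge> 1" for j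
      using that
    proof (induction j rule: nat_induct_at_least)
      case base
      show ?case using g1_ge .
    next
      case (Suc j)
      then show ?case using step(2,3)[of j] by (simp add: algebra_simps)
    qed
    have growth: "2 * \<gamma> 1 / (L - \<mu>) \<le> (1 - sqrt q) ^ (2 * k - 4) * A k"
      using k2
    proof (induction k rule: nat_induct_at_least)
      case base
      show ?case using A2 by simp
    next
      case (Suc j)
      then have j: "j \<ge> 1" by simp
      have "A j \<le> (1 - sqrt q)\<^sup>2 * A (j + 1)"
        using weight_growth_strongly_convex[OF mu_pos mu(2) _ r q ratio[OF j]] inv[OF j]
        by (simp only: step(1,2)[OF j])
      then have "(1 - sqrt q) ^ (2 * j - 4) * A j
          \<le> (1 - sqrt q) ^ (2 * j - 4) * ((1 - sqrt q)\<^sup>2 * A (j + 1))"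
        using q01 by (intro mult_left_mono) auto
      also have "\<dots> = (1 - sqrt q) ^ (2 * j - 4 + 2) * A (j + 1)"
        by (simp only: power_add mult.assoc)
      also have "2 * j - 4 + 2 = 2 * Suc j - 4" using Suc.hyps by simp
      finally show ?case using Suc.IH by simp
    qed
    have g_pos: "\<gamma> k > 0" and Ak: "A k > 0" using inv[OF k] A_pos[OF k2] by auto
    have "0 \<le> A k * gap xstar (y k)" using Ak gap_nonneg[OF opt] by simp
    then have "(primal_norm B (v k - xstar))\<^sup>2 * \<gamma> k \<le> 2 * D1"
      using Phi_bound[OF k] by (simp add: mult.commute)
    then have c1: "(primal_norm B (v k - xstar))\<^sup>2 \<le> 2 * D1 / \<gamma> k"
      using g_pos by (simp add: pos_le_divide_eq)
    have den: "\<mu> * r * A k > 0" using mu_pos r_pos Ak by simp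
    have "2 * D1 / \<gamma> k \<le> 2 * D1 / (2 * \<mu> * r * A k)"
      using ratio[OF k] D1_nonneg den g_pos by (intro divide_left_mono) auto
    then have c2: "2 * D1 / \<gamma> k \<le> D1 / (\<mu> * r * A k)" by simp
    let ?p = "(1 - sqrt q) ^ (2 * k - 4)"
    have "1 / A k \<le> ?p * ((L - \<mu>) / (2 * \<gamma> 1))"
      using growth Ak g1 mu by (simp add: field_simps)
    then have "D1 / (\<mu> * r) * (1 / A k) \<le> D1 / (\<mu> * r) * (?p * ((L - \<mu>) / (2 * \<gamma> 1)))"
      using D1_nonneg mu_pos r_pos by (intro mult_left_mono) auto
    also have "\<dots> = ?p * ((L - \<mu>) / (\<mu> * r * 4)) * Dbar1"
      by (simp add: Dbar1 mult_ac)
    also have "(L - \<mu>) / (\<mu> * r * 4) = (1 - q)\<^sup>2 / (4 * q)"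
      using mu_pos mu L by (simp add: r q field_simps power2_eq_square)
    finally have c3: "D1 / (\<mu> * r * A k) \<le> ?p * ((1 - q)\<^sup>2 / (4 * q)) * Dbar1" by simp
    have c4: "f (v k) - fstar \<le> L / 2 * (primal_norm B (v k - xstar))\<^sup>2"
      using bounds[of "v k" xstar] \<open>f' xstar = 0\<close> by (simp add: fstar)
    have "L / 2 * (primal_norm B (v k - xstar))\<^sup>2 \<le> L / 2 * (?p * ((1 - q)\<^sup>2 / (4 * q)) * Dbar1)"
      using c1 c2 c3 L by (intro mult_left_mono) auto
    also have "\<dots> = ?p * ((1 - q)\<^sup>2 * L / (8 * q)) * Dbar1" by simp
    finally show ?thesis using c1 c2 c3 c4 by blast
  qed
  show ?thesis using convex_case strong_case by blast
qed

end
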